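(* Let $n\ge 7$ be odd. There exists a positive constant $c_1$ depending only on $n$ such that for every positive integer $N$ with $|\mathcal{L}_n(N)|>0$ we have $|\mathcal{L}_n(N)|\ge c_1N^{\frac{3}{n-1}}$, and for every positive integer $N$ with $|\mathcal{L}_{\ge n}(N)|>0$ we have $|\mathcal{L}_{\ge n}(N)|\ge c_1N^{\frac{3}{n-1}}$.
   Context: For integers $A,B$ the Lucas sequence $U$ is $U_0=0$, $U_1=1$, $U_n=AU_{n-1}-BU_{n-2}$ $(n\ge2)$; with $\alpha,\beta$ the roots of $x^2-Ax+B$, $U$ is non-degenerate if $AB\neq0$ and $\alpha/\beta$ is not a root of unity. $\mathcal{L}_n(N)$ is the set of integers $x$ with $0\le x\le N$ and $x=|U_n|$ for some non-degenerate Lucas sequence $U$, and $\mathcal{L}_{\ge n}(N)=\bigcup_{m\ge n}\mathcal{L}_m(N)$. *)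

theory Defs
  imports Complex_Main "HOL-Computational_Algebra.Polynomial"
begin

fun lucas_U :: "int \<Rightarrow> int \<Rightarrow> nat \<Rightarrow> int" where
  "lucas_U A B 0 = 0"
| "lucas_U A B (Suc 0) = 1"
| "lucas_U A B (Suc (Suc n)) = A * lucas_U A B (Suc n) - B * lucas_U A B n"

definition root_of_unity :: "complex \<Rightarrow> bool" where
  "root_of_unity z \<longleftrightarrow> (\<exists>k::nat. k > 0 \<and> z ^ k = 1)"

(* The pair \<alpha>, \<beta> lists the roots of X^2 - A X + B with multiplicity (hence the
   factorization); it is determined up to order, and a double root gives the ratio 1,
   so it counts as degenerate. *)
definition nondegenerate :: "int \<Rightarrow> int \<Rightarrow> bool" where
  "nondegenerate A B \<longleftrightarrow> A * B \<noteq> 0 \<and>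
     (\<forall>\<alpha> \<beta> :: complex. [:of_int B, - of_int A, 1:] = [:- \<alpha>, 1:] * [:- \<beta>, 1:]
        \<longrightarrow> \<not> root_of_unity (\<alpha> / \<beta>))"

definition lucas_values :: "nat \<Rightarrow> nat \<Rightarrow> int set" where
  "lucas_values n N =
     {x. 0 \<le> x \<and> x \<le> int N \<and> (\<exists>A B. nondegenerate A B \<and> x = \<bar>lucas_U A B n\<bar>)}"

definition lucas_values_ge :: "nat \<Rightarrow> nat \<Rightarrow> int set" where
  "lucas_values_ge n N = (\<Union>m\<in>{n..}. lucas_values m N)"

(* Both sets are finite, so card is their true cardinality. *)
lemma finite_lucas_values: "finite (lucas_values n N)"
  by (rule finite_subset[of _ "{0..int N}"]) (auto simp: lucas_values_def)

lemma finite_lucas_values_ge: "finite (lucas_values_ge n N)"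
  by (rule finite_subset[of _ "{0..int N}"]) (auto simp: lucas_values_ge_def lucas_values_def)

end

theory Submission
  imports Defs "HOL-Number_Theory.Cong" "HOL-Library.FuncSet"
begin

text \<open>
  The idea is that of Erdos and Mahler for values of binary forms. Take \<open>A = 2na\<close> and
  \<open>B = -b\<close> with \<open>b = 1 + 2nj\<close>, where \<open>a \<le> M\<close> and \<open>M\<^sup>2 \<le> j < 2M\<^sup>2\<close>. The negative sign
  of \<open>B\<close> makes the sequence positive and non-degenerate, and \<open>h = U\<^sub>n(A, B)\<close> has order \<open>M\<^bsup>n-1\<^esup>\<close>.
  If \<open>A\<close> and \<open>b\<close> are coprime and \<open>p\<close> divides \<open>h\<close>, then \<open>p\<close> does not divide \<open>nA\<close>, and \<open>b / A\<^sup>2\<close> is a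
  root modulo \<open>p\<close> of the Jacobsthal polynomial \<open>U\<^sub>n(1, -X)\<close>; all these roots are simple, so they lift
  uniquely to roots modulo \<open>p\<^sup>k\<close>.

  Let \<open>M = z\<^bsup>20n\<^esup>\<close>. A positive proportion of the pairs is coprime, and by a first moment estimate
  based on \<open>\<Sum>\<^bsub>p \<le> z\<^esub> ln p / p \<le> 2 ln z\<close>, for most of these the part of \<open>h\<close> composed of primes \<open>p \<le> z\<close>
  is at most \<open>M\<close>. The remaining part \<open>q\<close> of \<open>h\<close> has boundedly many prime factors. If two pairs share
  \<open>h\<close> and the residues \<open>b / A\<^sup>2\<close> modulo all these primes, then \<open>q\<close> divides \<open>b A'\<^sup>2 - b' A\<^sup>2\<close>, which
  is of order \<open>M\<^sup>4\<close>, whereas \<open>q \<ge> M\<^sup>5\<close> because \<open>n \<ge> 7\<close>. So the pairs coincide, every value is taken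
  boundedly often, and there are \<open>\<gg> M\<^sup>3\<close> values.
\<close>

section \<open>Roots of integer polynomials modulo primes and prime powers\<close>

text \<open>Lagrange's theorem over the field with \<open>p\<close> elements, in integer
  representatives. Synthetic division by a root \<open>r\<close> gives
  \<open>f = [:- r, 1:] * q + [:poly f r:]\<close>; as \<open>p\<close> divides
  \<open>poly f r\<close>, some coefficient of \<open>q\<close> escapes \<open>p\<close>, and every
  other root of \<open>f\<close> modulo \<open>p\<close> is a root of \<open>q\<close>.\<close>

lemma card_roots_mod_prime:
  fixes f :: "int poly" and p :: int
  assumes "prime p" "\<not> p dvd coeff f i"
  shows "card {s \<in> {0..<p}. p dvd poly f s} \<le> degree f"
  using assms(2)
proof (induction "degree f" arbitrary: f i rule: less_induct)
  case less
  show ?case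
  proof (cases "\<exists>r\<in>{0..<p}. p dvd poly f r")
    case False
    then have "{s \<in> {0..<p}. p dvd poly f s} = {}" by auto
    then show ?thesis by (simp only: card.empty)
  next
    case True
    then obtain r where r: "r \<in> {0..<p}" "p dvd poly f r" by auto
    define q where "q = synthetic_div f r"
    have f: "f = [:- r, 1:] * q + [:poly f r:]"
      using synthetic_div_correct'[of r f] by (simp add: q_def)
    have pos: "degree f \<noteq> 0"
    proof
      assume "degree f = 0"
      then obtain c where "f = [:c:]" by (rule degree_eq_zeroE)
      with r less.prems show False by (auto simp: coeff_pCons split: nat.splits)
    qed
    have deg: "degree q = degree f - 1"
      by (simp add: q_def degree_synthetic_div)
    have "\<exists>k. \<not> p dvd coeff q k"
    proof (rule ccontr)
      assume "\<not> ?thesis"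
      then have "p dvd coeff q k" for k by auto
      then have "p dvd coeff ([:- r, 1:] * q) i"
        by (auto simp: coeff_pCons split: nat.splits)
      moreover have "p dvd coeff [:poly f r:] i"
        using r by (auto simp: coeff_pCons split: nat.splits)
      ultimately have "p dvd coeff ([:- r, 1:] * q + [:poly f r:]) i" by (simp only: coeff_add dvd_add)
      with less.prems f show False by metis
    qed
    then have IH: "card {s \<in> {0..<p}. p dvd poly q s} \<le> degree q"
      using less.hyps[of q] deg pos by auto
    have "{s \<in> {0..<p}. p dvd poly f s} \<subseteq> insert r {s \<in> {0..<p}. p dvd poly q s}"
    proof safe
      fix s assume s: "s \<in> {0..<p}" "p dvd poly f s" "s \<noteq> r"
      have "poly f s = (s - r) * poly q s + poly f r"
        by (subst f) (simp add: algebra_simps)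
      then have "p dvd (s - r) * poly q s"
        using s r by (metis add_diff_cancel_right' dvd_diff)
      moreover have "\<not> p dvd s - r"
      proof
        assume "p dvd s - r"
        then have "s mod p = r mod p" by (simp add: mod_eq_dvd_iff)
        with s r show False by simp
      qed
      ultimately show "p dvd poly q s" using assms(1) by (simp add: prime_dvd_mult_iff)
    qed
    then have "card {s \<in> {0..<p}. p dvd poly f s} \<le> card (insert r {s \<in> {0..<p}. p dvd poly q s})"
      by (intro card_mono finite.insertI finite_Collect_conjI disjI1) simp_all
    also have "\<dots> \<le> Suc (card {s \<in> {0..<p}. p dvd poly q s})" by (rule card_insert_le_m1) auto
    also have "\<dots> \<le> degree f" using IH deg pos by simp
    finally show ?thesis .
  qed
qed

text \<open>The quadratic remainder is only asserted to exist, which avoids any division by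
  2.\<close>

lemma poly_taylor2:
  fixes f :: "'a::idom poly"
  shows "\<exists>r. poly f (x + h) = poly f x + h * poly (pderiv f) x + h\<^sup>2 * r"
proof (induction f)
  case 0
  then show ?case by auto
next
  case (pCons a f)
  then obtain r where r: "poly f (x + h) = poly f x + h * poly (pderiv f) x + h\<^sup>2 * r" by blast
  have "poly (pCons a f) (x + h) = a + (x + h) * (poly f x + h * poly (pderiv f) x + h\<^sup>2 * r)"
    by (simp only: poly_pCons r)
  then have "poly (pCons a f) (x + h) = poly (pCons a f) x + h * poly (pderiv (pCons a f)) x
      + h\<^sup>2 * (x * r + poly (pderiv f) x + h * r)"
    by (simp add: pderiv_pCons algebra_simps power2_eq_square)
  then show ?case by blast
qed

text \<open>The uniqueness half of Hensel's lemma: by Taylor, \<open>poly f t - poly f s\<close> is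
  \<open>t - s\<close> times a factor congruent to \<open>poly (pderiv f) s\<close> modulo
  \<open>p\<close>, and that factor is prime to \<open>p\<close>.\<close>

lemma hensel_unique:
  fixes f :: "int poly" and p :: int
  assumes "prime p" "p ^ k dvd poly f s" "p ^ k dvd poly f t" "p dvd t - s"
    and "\<not> p dvd poly (pderiv f) s"
  shows "p ^ k dvd t - s"
proof -
  obtain r where r: "poly f (s + (t - s)) = poly f s + (t - s) * poly (pderiv f) s + (t - s)\<^sup>2 * r"
    using poly_taylor2 by blast
  then have "poly f t - poly f s = (poly (pderiv f) s + (t - s) * r) * (t - s)"
    by (simp add: algebra_simps power2_eq_square)
  then have "p ^ k dvd (poly (pderiv f) s + (t - s) * r) * (t - s)"
    using assms(2,3) by (metis dvd_diff)
  moreover have "\<not> p dvd poly (pderiv f) s + (t - s) * r"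
    using assms(4,5) by (simp add: dvd_add_left_iff)
  ultimately show ?thesis
    using assms(1) by (metis coprime_dvd_mult_right_iff coprime_power_left_iff prime_imp_coprime)
qed

section \<open>Jacobsthal polynomials: homogeneity and simple roots modulo primes\<close>

text \<open>The Jacobsthal polynomials \<open>jacobsthal n = U\<^sub>n(1, -X)\<close>.\<close>

fun jacobsthal :: "nat \<Rightarrow> int poly" where
  "jacobsthal 0 = 0"
| "jacobsthal (Suc 0) = 1"
| "jacobsthal (Suc (Suc n)) = jacobsthal (Suc n) + [:0, 1:] * jacobsthal n"

text \<open>\<open>lucas_U A B n\<close> is homogeneous of degree \<open>n - 1\<close> when
  \<open>A\<close> has weight 1 and \<open>B\<close> has weight 2. The extra factor \<open>A\<close>
  raises the exponent to \<open>n\<close> and keeps \<open>n = 0\<close> valid.\<close>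

lemma lucas_U_homogeneous:
  "A * lucas_U A (- (s * A\<^sup>2)) n = A ^ n * poly (jacobsthal n) s"
proof (induction n rule: jacobsthal.induct)
  case (3 n)
  have "A * lucas_U A (- (s * A\<^sup>2)) (Suc (Suc n))
    = A * (A * lucas_U A (- (s * A\<^sup>2)) (Suc n)) + s * A\<^sup>2 * (A * lucas_U A (- (s * A\<^sup>2)) n)"
    by (simp add: algebra_simps)
  also have "\<dots> = A ^ Suc (Suc n) * poly (jacobsthal (Suc (Suc n))) s"
    unfolding 3 by (simp add: algebra_simps power2_eq_square)
  finally show ?case .
qed auto

lemma degree_jacobsthal: "degree (jacobsthal n) \<le> n"
proof (induction n rule: jacobsthal.induct)
  case (3 n)
  then show ?case by (auto intro!: degree_add_le)
qed auto

lemma jacobsthal_0: "poly (jacobsthal (Suc n)) 0 = 1"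
  by (induction n) auto

lemma jacobsthal_cong_1: "s dvd poly (jacobsthal (Suc n)) s - 1"
proof (induction n)
  case (Suc n)
  have "poly (jacobsthal (Suc (Suc n))) s - 1 = (poly (jacobsthal (Suc n)) s - 1) + s * poly (jacobsthal n) s"
    by simp
  then show ?case using Suc by (simp only: dvd_add dvd_triv_left)
qed simp

text \<open>The factor \<open>1 + 4 * x\<close> is the discriminant of \<open>T^2 - T - x\<close>,
  the characteristic polynomial of the recurrence. At a root of \<open>jacobsthal (Suc n)\<close>
  the identity ties the derivative to \<open>jacobsthal n\<close>.\<close>

lemma jacobsthal_pderiv:
  "(1 + 4 * x) * poly (pderiv (jacobsthal (Suc n))) x
     = 2 * int n * poly (jacobsthal (Suc n)) x - int (Suc n) * poly (jacobsthal n) x"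
proof (induction n rule: jacobsthal.induct)
  case (3 n)
  have "(1 + 4 * x) * poly (pderiv (jacobsthal (Suc (Suc (Suc n))))) x
      = (1 + 4 * x) * poly (pderiv (jacobsthal (Suc (Suc n)))) x
        + (1 + 4 * x) * poly (jacobsthal (Suc n)) x
        + x * ((1 + 4 * x) * poly (pderiv (jacobsthal (Suc n))) x)"
    by (simp only: jacobsthal.simps(3)[of "Suc n"] pderiv_add pderiv_mult)
       (simp add: pderiv_pCons algebra_simps)
  also have "\<dots> = 2 * int (Suc (Suc n)) * poly (jacobsthal (Suc (Suc (Suc n)))) x
       - int (Suc (Suc (Suc n))) * poly (jacobsthal (Suc (Suc n))) x"
    unfolding 3 by (simp add: algebra_simps)
  finally show ?case .
qed (auto simp: pderiv_pCons algebra_simps)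

text \<open>A common prime divisor descends along the recurrence to \<open>jacobsthal 1 = 1\<close>.
  The descent cancels \<open>x\<close>, which \<open>p\<close> cannot divide because the value is 1
  modulo \<open>x\<close>.\<close>

lemma jacobsthal_no_common_prime:
  fixes p :: int
  assumes "prime p" "p dvd poly (jacobsthal (Suc n)) x" "p dvd poly (jacobsthal n) x"
  shows False
  using assms(2,3)
proof (induction n)
  case 0
  then show ?case using assms(1) by (auto simp: prime_int_iff)
next
  case (Suc n)
  have "p dvd poly (jacobsthal (Suc (Suc n))) x - poly (jacobsthal (Suc n)) x"
    using Suc.prems by (rule dvd_diff)
  then have "p dvd x * poly (jacobsthal n) x" by simp
  moreover have "\<not> p dvd x"
  proof
    assume "p dvd x"
    then have "p dvd poly (jacobsthal (Suc n)) x - 1" using jacobsthal_cong_1 dvd_trans by blast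
    with Suc.prems have "p dvd 1" by (metis dvd_diff_right_iff)
    then show False using assms(1) by auto
  qed
  ultimately have "p dvd poly (jacobsthal n) x" using assms(1) by (simp add: prime_dvd_mult_iff)
  then show ?case using Suc by blast
qed

text \<open>At a multiple root, \<open>jacobsthal_pderiv\<close> would make \<open>p\<close> divide
  \<open>n\<close> times the preceding Jacobsthal value, but \<open>p\<close> does not divide
  \<open>n\<close> and consecutive values share no prime.\<close>

lemma jacobsthal_simple_root:
  fixes p :: int
  assumes "prime p" "\<not> p dvd int n" "p dvd poly (jacobsthal n) x" "n > 0"
  shows "\<not> p dvd poly (pderiv (jacobsthal n)) x"
proof
  assume a: "p dvd poly (pderiv (jacobsthal n)) x"
  obtain m where n: "n = Suc m" using assms(4) by (cases n) auto
  have "int n * poly (jacobsthal m) x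
    = 2 * int m * poly (jacobsthal n) x - (1 + 4 * x) * poly (pderiv (jacobsthal n)) x"
    using jacobsthal_pderiv[of x m] n by simp
  then have "p dvd int n * poly (jacobsthal m) x" using assms(3) a by simp
  then have "p dvd poly (jacobsthal m) x" using assms(1,2) by (simp add: prime_dvd_mult_iff)
  then show False using jacobsthal_no_common_prime assms(1,3) n by blast
qed

section \<open>The residue \<open>b / A^2\<close> attached to a pair\<close>

lemma lucas_U_cong:
  assumes "[B = B'] (mod m)"
  shows "[lucas_U A B n = lucas_U A B' n] (mod m)"
proof (induction n rule: jacobsthal.induct)
  case (3 n)
  then show ?case by (auto intro!: cong_diff cong_mult assms)
qed auto

text \<open>\<open>t\<close> stands for the quotient \<open>b / A^2\<close> modulo \<open>m\<close>,
  which homogeneity turns into a root of a Jacobsthal polynomial.\<close>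

lemma ex_projective_root:
  fixes m :: int
  assumes "coprime A m"
  shows "\<exists>t. [t * A\<^sup>2 = b] (mod m)"
proof -
  have "coprime (A\<^sup>2) m" using assms by simp
  then obtain x where "[A\<^sup>2 * x = 1] (mod m)" using cong_solve_coprime_int by blast
  then have "[A\<^sup>2 * x * b = 1 * b] (mod m)" by (rule cong_mult) simp
  then have "[(x * b) * A\<^sup>2 = b] (mod m)" by (simp add: ac_simps)
  then show ?thesis by blast
qed

lemma dvd_jacobsthal_projective_root:
  fixes m :: int
  assumes "coprime A m" "[t * A\<^sup>2 = b] (mod m)" "m dvd lucas_U A (- b) n"
  shows "m dvd poly (jacobsthal n) t"
proof -
  have "[lucas_U A (- (t * A\<^sup>2)) n = lucas_U A (- b) n] (mod m)"
    by (intro lucas_U_cong) (use assms(2) in \<open>simp add: cong_minus_minus_iff\<close>)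
  then have "m dvd lucas_U A (- (t * A\<^sup>2)) n" using assms(3) cong_dvd_iff by blast
  then have "m dvd A ^ n * poly (jacobsthal n) t"
    by (metis lucas_U_homogeneous dvd_mult)
  then show ?thesis using assms(1)
    by (metis coprime_commute coprime_dvd_mult_right_iff coprime_power_right_iff)
qed

text \<open>The quotients \<open>t = b / A^2\<close> and \<open>t' = b' / A'^2\<close> modulo
  \<open>p ^ k\<close> are roots of \<open>jacobsthal n\<close> that both reduce to \<open>s\<close>
  modulo \<open>p\<close>. The roots are simple, so \<open>t\<close> and \<open>t'\<close> agree
  modulo \<open>p ^ k\<close>; clearing denominators gives the claim.\<close>

lemma prime_power_dvd_cross_difference:
  fixes p :: int
  assumes p: "prime p" "\<not> p dvd int n" "n > 0"
    and A: "\<not> p dvd A" "\<not> p dvd A'"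
    and s: "[s * A\<^sup>2 = b] (mod p)" "[s * A'\<^sup>2 = b'] (mod p)"
    and U: "p ^ k dvd lucas_U A (- b) n" "p ^ k dvd lucas_U A' (- b') n"
  shows "p ^ k dvd b * A'\<^sup>2 - b' * A\<^sup>2"
proof (cases "k = 0")
  case False
  have cop: "coprime A (p ^ k)" "coprime A' (p ^ k)" "coprime A p" "coprime A' p"
    using prime_imp_coprime[OF p(1) A(1)] prime_imp_coprime[OF p(1) A(2)]
    by (simp_all add: coprime_commute)
  have pk: "p dvd p ^ k" using False by (simp add: dvd_power)
  obtain t where t: "[t * A\<^sup>2 = b] (mod p ^ k)" using ex_projective_root cop by blast
  obtain t' where t': "[t' * A'\<^sup>2 = b'] (mod p ^ k)" using ex_projective_root cop by blast
  have roots: "p ^ k dvd poly (jacobsthal n) t" "p ^ k dvd poly (jacobsthal n) t'"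
    using dvd_jacobsthal_projective_root cop t t' U by blast+
  have "[t * A\<^sup>2 = s * A\<^sup>2] (mod p)"
    using cong_dvd_modulus[OF t pk] s(1) by (meson cong_sym cong_trans)
  then have ts: "[t = s] (mod p)" using cop by (simp add: cong_mult_rcancel)
  have "[t' * A'\<^sup>2 = s * A'\<^sup>2] (mod p)"
    using cong_dvd_modulus[OF t' pk] s(2) by (meson cong_sym cong_trans)
  then have ts': "[t' = s] (mod p)" using cop by (simp add: cong_mult_rcancel)
  have "p dvd t' - t" using ts ts' by (meson cong_iff_dvd_diff cong_sym cong_trans)
  moreover have "\<not> p dvd poly (pderiv (jacobsthal n)) t"
    using jacobsthal_simple_root[OF p(1,2) _ p(3)] roots(1) pk dvd_trans by blast
  ultimately have "p ^ k dvd t' - t" using hensel_unique p(1) roots by blast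
  then have "[t = t'] (mod p ^ k)" by (metis cong_iff_dvd_diff cong_sym)
  then have "[t * A\<^sup>2 * A'\<^sup>2 = t' * A'\<^sup>2 * A\<^sup>2] (mod p ^ k)"
    by (metis cong_scalar_right mult.assoc mult.commute)
  moreover have "[t * A\<^sup>2 * A'\<^sup>2 = b * A'\<^sup>2] (mod p ^ k)" using t by (rule cong_scalar_right)
  moreover have "[t' * A'\<^sup>2 * A\<^sup>2 = b' * A\<^sup>2] (mod p ^ k)" using t' by (rule cong_scalar_right)
  ultimately have "[b * A'\<^sup>2 = b' * A\<^sup>2] (mod p ^ k)" by (meson cong_sym cong_trans)
  then show ?thesis by (simp add: cong_iff_dvd_diff)
qed auto

section \<open>Non-degeneracy, size and coprimality for negative \<open>B\<close>\<close>

text \<open>The discriminant is positive, so both roots are real. If their ratio is a root of unity,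
  they are equal, whence \<open>B \<ge> 0\<close>, or opposite, whence \<open>A = 0\<close>.\<close>

lemma nondegenerate_neg:
  assumes "A \<noteq> 0" "B < 0"
  shows "nondegenerate A B"
  unfolding nondegenerate_def
proof (intro conjI allI impI notI)
  show "A * B = 0 \<Longrightarrow> False" using assms by simp
next
  fix \<alpha> \<beta> :: complex
  assume eq: "[:of_int B, - of_int A, 1:] = [:- \<alpha>, 1:] * [:- \<beta>, 1:]" and "root_of_unity (\<alpha> / \<beta>)"
  then obtain k :: nat where k: "k > 0" "(\<alpha> / \<beta>) ^ k = 1" by (auto simp: root_of_unity_def)
  have "- \<beta> - \<alpha> = - of_int A" using eq by simp
  moreover have "\<alpha> + \<beta> = - (- \<beta> - \<alpha>)" by simp
  ultimately have sum: "\<alpha> + \<beta> = of_int A" by simp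
  have prod: "\<alpha> * \<beta> = of_int B" using eq by simp
  have "(\<alpha> - \<beta>)\<^sup>2 = (\<alpha> + \<beta>)\<^sup>2 - 4 * (\<alpha> * \<beta>)" by (simp add: algebra_simps power2_eq_square)
  also have "\<dots> = of_real (real_of_int (A\<^sup>2 - 4 * B))" by (simp add: sum prod)
  \<comment> \<open>Writing the discriminant as the square of a real number makes
    \<open>\<alpha> - \<beta>\<close> plus or minus that number, hence real.\<close>
  also have "real_of_int (A\<^sup>2 - 4 * B) = (sqrt (real_of_int (A\<^sup>2 - 4 * B)))\<^sup>2"
    using assms by (subst real_sqrt_pow2) (auto intro: order_trans[OF _ zero_le_power2])
  finally have "(\<alpha> - \<beta>)\<^sup>2 = (of_real (sqrt (real_of_int (A\<^sup>2 - 4 * B))))\<^sup>2"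
    by (simp only: of_real_power)
  then have "\<alpha> - \<beta> \<in> \<real>" unfolding power2_eq_iff by auto
  moreover have "\<alpha> + \<beta> \<in> \<real>" by (simp add: sum)
  ultimately have "(\<alpha> + \<beta>) + (\<alpha> - \<beta>) \<in> \<real>" "(\<alpha> + \<beta>) - (\<alpha> - \<beta>) \<in> \<real>"
    by (auto simp only: Reals_add Reals_diff)
  then have "2 * \<alpha> \<in> \<real>" "2 * \<beta> \<in> \<real>" by (simp_all add: algebra_simps)
  then have "2 * \<alpha> / 2 \<in> \<real>" "2 * \<beta> / 2 \<in> \<real>" by (blast intro: Reals_divide Reals_numeral)+
  then obtain x y where xy: "\<alpha> = of_real x" "\<beta> = of_real y" by (auto elim!: Reals_cases)
  have "norm (\<alpha> / \<beta>) ^ k = 1 ^ k" by (simp only: k norm_one power_one flip: norm_power)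
  then have "norm (\<alpha> / \<beta>) = 1" by (rule power_eq_imp_eq_base) (use k in auto)
  then have "norm \<alpha> = norm \<beta>" by (simp add: norm_divide)
  then have "\<bar>x\<bar> = \<bar>y\<bar>" by (simp add: xy)
  then have xy': "x = y \<or> x + y = 0" by linarith
  have "complex_of_real (x + y) = of_real (of_int A)" "complex_of_real (x * y) = of_real (of_int B)"
    using sum prod xy by simp_all
  then have AB: "x + y = of_int A" "x * y = of_int B" by (simp_all only: of_real_eq_iff)
  show False
    using xy'
  proof
    assume "x = y"
    with AB have "real_of_int B = x * x" by simp
    then have "0 \<le> real_of_int B" by simp
    with assms show False by simp
  qed (use AB assms in simp)
qed

text \<open>With \<open>A\<close> of size \<open>y\<close> and \<open>b\<close> of size
  \<open>y^2\<close>, both summands of the recurrence have the same order; the induction closes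
  because \<open>2 + 1 \<le> 4\<close>.\<close>

lemma lucas_U_neg_bounds:
  assumes "0 \<le> A" "A \<le> y" "0 \<le> b" "b \<le> y\<^sup>2"
  shows "0 \<le> lucas_U A (- b) (Suc m) \<and> lucas_U A (- b) (Suc m) \<le> (2 * y) ^ m"
proof (induction m rule: jacobsthal.induct)
  case 2
  then show ?case using assms by simp
next
  case (3 m)
  have y: "0 \<le> y" using assms by linarith
  have "A * lucas_U A (- b) (Suc (Suc m)) \<le> y * (2 * y) ^ Suc m"
    using 3 assms y by (intro mult_mono) auto
  moreover have "b * lucas_U A (- b) (Suc m) \<le> y\<^sup>2 * (2 * y) ^ m"
    using 3 assms y by (intro mult_mono) auto
  ultimately have "lucas_U A (- b) (Suc (Suc (Suc m))) \<le> y * (2 * y) ^ Suc m + y\<^sup>2 * (2 * y) ^ m" by simp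
  also have "\<dots> = 3 * (y\<^sup>2 * (2 * y) ^ m)" by (simp add: power2_eq_square)
  also have "\<dots> \<le> 4 * (y\<^sup>2 * (2 * y) ^ m)" using y by simp
  also have "\<dots> = (2 * y) ^ Suc (Suc m)" by (simp add: power2_eq_square)
  finally have "lucas_U A (- b) (Suc (Suc (Suc m))) \<le> (2 * y) ^ Suc (Suc m)" .
  moreover have "0 \<le> lucas_U A (- b) (Suc (Suc (Suc m)))" using 3 assms by simp
  ultimately show ?case by blast
qed auto

text \<open>By nonnegativity the \<open>A\<close>-term may be dropped in every second step, which
  leaves a factor \<open>b\<close> each time.\<close>

lemma lucas_U_neg_odd_ge:
  assumes "0 \<le> A" "0 \<le> b"
  shows "b ^ m \<le> lucas_U A (- b) (2 * m + 1)"
proof -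
  have nonneg: "0 \<le> lucas_U A (- b) k" for k
    by (induction k rule: jacobsthal.induct) (use assms in auto)
  show ?thesis
  proof (induction m)
    case (Suc m)
    have "b ^ Suc m \<le> b * lucas_U A (- b) (2 * m + 1)" using Suc assms by (simp add: mult_left_mono)
    also have "\<dots> \<le> lucas_U A (- b) (2 * Suc m + 1)"
      using nonneg[of "2 * m + 2"] assms by (simp add: numeral_2_eq_2)
    finally show ?case .
  qed simp
qed

lemma lucas_U_odd_cong: "[lucas_U A B (2 * m + 1) = (- B) ^ m] (mod A)"
proof (induction m)
  case (Suc m)
  have "lucas_U A B (2 * Suc m + 1) = A * lucas_U A B (2 * m + 2) + (- B) * lucas_U A B (2 * m + 1)"
    by (simp add: numeral_2_eq_2)
  moreover have "[A * lucas_U A B (2 * m + 2) + (- B) * lucas_U A B (2 * m + 1) = 0 + (- B) * (- B) ^ m] (mod A)"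
    by (intro cong_add cong_mult Suc) (auto simp: cong_0_iff)
  ultimately show ?case by simp
qed simp

text \<open>Modulo \<open>A\<close> the sequence is multiplied by \<open>- B\<close> every two
  steps, so an odd index leads back to a power of \<open>- B\<close>, whereas an even index leads to
  0.\<close>

lemma coprime_lucas_U_odd:
  assumes "coprime A B" "odd n"
  shows "coprime A (lucas_U A B n)"
proof -
  obtain m where "n = 2 * m + 1" using assms(2) by (rule oddE)
  then have "[lucas_U A B n = (- B) ^ m] (mod A)" using lucas_U_odd_cong by simp
  moreover have "coprime A ((- B) ^ m)" using assms by simp
  ultimately show ?thesis by (metis cong_imp_coprime cong_sym coprime_commute)
qed

section \<open>Counting in residue classes and a Mertens-type bound\<close>

text \<open>Members of one class modulo \<open>m\<close> are told apart by the quotient of their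
  offset from \<open>L\<close>, which ranges over \<open>0..X div m\<close>.\<close>

lemma card_congruent_le:
  fixes J :: "nat set"
  assumes "J \<subseteq> {L..<L + X}" "m > 0" "\<And>i j. i \<in> J \<Longrightarrow> j \<in> J \<Longrightarrow> [i = j] (mod m)"
  shows "card J \<le> X div m + 1"
proof -
  have "inj_on (\<lambda>j. (j - L) div m) J"
  proof (rule inj_onI)
    fix i j assume ij: "i \<in> J" "j \<in> J" "(i - L) div m = (j - L) div m"
    have L: "L \<le> i" "L \<le> j" using ij assms(1) by auto
    have "[(i - L) + L = (j - L) + L] (mod m)" using assms(3) ij L by simp
    then have "[i - L = j - L] (mod m)" by (simp only: cong_add_rcancel_nat)
    then have "(i - L) mod m = (j - L) mod m" by (simp only: cong_def)
    then have "i - L = j - L" using ij(3) by (metis div_mult_mod_eq)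
    then show "i = j" using L by linarith
  qed
  then have "card J = card ((\<lambda>j. (j - L) div m) ` J)" by (simp add: card_image)
  also have "\<dots> \<le> card {0..X div m}"
  proof (intro card_mono)
    have "j - L \<le> X" if "j \<in> J" for j using subsetD[OF assms(1) that] unfolding atLeastLessThan_iff by linarith
    then show "(\<lambda>j. (j - L) div m) ` J \<subseteq> {0..X div m}"
      by (intro image_subsetI) (simp add: div_le_mono)
  qed simp
  finally show ?thesis by simp
qed

lemma card_multiples: "p > 0 \<Longrightarrow> card {m \<in> {1..z}. p dvd m} = z div (p::nat)"
proof -
  assume p: "p > 0"
  have "{m \<in> {1..z}. p dvd m} = (\<lambda>i. p * i) ` {1..z div p}"
    using p by (auto simp: dvd_def less_eq_div_iff_mult_less_eq ac_simps Suc_le_eq)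
  then show ?thesis using p by (simp add: card_image inj_on_def)
qed

text \<open>Pairs \<open>p dvd m\<close> with \<open>m \<le> z\<close> are counted with weight
  \<open>ln p\<close> in two ways: each \<open>p\<close> has \<open>z div p\<close> multiples, and
  for each \<open>m\<close> the product of its primes divides \<open>m\<close>, so it is at most
  \<open>z\<close>. The factor 2 pays for replacing \<open>z div p\<close> by
  \<open>z / p\<close>.\<close>

lemma sum_ln_prime_over_prime_le:
  assumes "z > 0"
  shows "(\<Sum>p | prime p \<and> p \<le> z. ln (real p) / real p) \<le> 2 * ln (real z)"
proof -
  let ?P = "{p. prime p \<and> p \<le> z}"
  have fin: "finite ?P" by simp
  have "real z / 2 * (\<Sum>p\<in>?P. ln p / p) \<le> (\<Sum>p\<in>?P. real (z div p) * ln p)"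
    unfolding sum_distrib_left
  proof (rule sum_mono)
    fix p assume "p \<in> ?P"
    then have p: "p > 0" "p \<le> z" by (auto simp: prime_gt_0_nat)
    have "z < p * (z div p + 1)" using p by (metis Suc_eq_plus1 dividend_less_times_div mult_Suc_right add.commute)
    \<comment> \<open>\<open>z div p\<close> is at least 1 because \<open>p \<le> z\<close>, so
      adding 1 at most doubles it.\<close>
    moreover have "p * (z div p + 1) \<le> p * (2 * (z div p))"
      using p by (intro mult_left_mono) (auto simp: Suc_le_eq div_greater_zero_iff)
    ultimately have "z \<le> 2 * (p * (z div p))" by linarith
    then have "real z \<le> 2 * (real p * real (z div p))" by (metis of_nat_le_iff of_nat_mult of_nat_numeral)
    then have "real z / 2 / p \<le> real (z div p)" using p by (simp add: field_simps)
    then have "real z / 2 / p * ln p \<le> real (z div p) * ln p" using p by (intro mult_right_mono) auto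
    then show "real z / 2 * (ln p / p) \<le> real (z div p) * ln p" by simp
  qed
  also have "\<dots> = (\<Sum>p\<in>?P. \<Sum>m | m \<in> {1..z} \<and> p dvd m. ln p)"
    by (intro sum.cong) (use card_multiples prime_gt_0_nat in force)+
  also have "\<dots> = (\<Sum>m\<in>{1..z}. \<Sum>p | p \<in> ?P \<and> p dvd m. ln p)"
    by (rule sum.swap_restrict) auto
  also have "\<dots> \<le> (\<Sum>m\<in>{1..z}. ln (real z))"
  proof (rule sum_mono)
    fix m assume m: "m \<in> {1..z}"
    have "[m = 0] (mod (\<Prod>p | p \<in> ?P \<and> p dvd m. p))"
      by (rule coprime_cong_prod_nat) (auto simp: primes_coprime cong_0_iff)
    then have "(\<Prod>p | p \<in> ?P \<and> p dvd m. p) dvd m" by (simp add: cong_0_iff)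
    then have "(\<Prod>p | p \<in> ?P \<and> p dvd m. p) \<le> z" using m by (auto dest: dvd_imp_le)
    then have "real (\<Prod>p | p \<in> ?P \<and> p dvd m. p) \<le> real z" by (simp only: of_nat_le_iff)
    moreover have "(\<Prod>p | p \<in> ?P \<and> p dvd m. p) > 0" by (auto intro!: prod_pos prime_gt_0_nat)
    ultimately have "ln (real (\<Prod>p | p \<in> ?P \<and> p dvd m. p)) \<le> ln (real z)"
      using assms by (metis ln_le_cancel_iff of_nat_0_less_iff)
    then show "(\<Sum>p | p \<in> ?P \<and> p dvd m. ln (real p)) \<le> ln (real z)"
      unfolding of_nat_prod by (subst (asm) ln_prod) (auto simp: prime_gt_0_nat)
  qed
  also have "\<dots> = real z * ln (real z)" by simp
  finally show ?thesis using assms by (simp add: field_simps)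
qed

section \<open>Smooth and rough parts of integers\<close>

text \<open>For \<open>h > 0\<close> this is the logarithm of the part of \<open>h\<close> composed
  of primes up to \<open>z\<close>. Summing over all these primes, not only the factors of
  \<open>h\<close>, allows an interchange with sums over many \<open>h\<close>.\<close>

definition smooth_log :: "nat \<Rightarrow> nat \<Rightarrow> real" where
  "smooth_log z h = (\<Sum>p | prime p \<and> p \<le> z. real (multiplicity p h) * ln (real p))"

lemma ln_prime_nonneg: "prime p \<Longrightarrow> 0 \<le> ln (real p)"
  using prime_ge_1_nat[of p] by simp

lemma smooth_log_nonneg: "0 \<le> smooth_log z h"
  unfolding smooth_log_def by (intro sum_nonneg mult_nonneg_nonneg) (auto simp: ln_prime_nonneg)

text \<open>The smooth factor \<open>s\<close> of \<open>h\<close> has \<open>ln s\<close> at most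
  \<open>smooth_log z h\<close>, hence \<open>s \<le> M\<close>; the product is the complementary
  factor.\<close>

lemma le_mult_rough_part:
  assumes "h > 0" "M > 0" "smooth_log z h \<le> ln (real M)"
  shows "h \<le> M * (\<Prod>p | p \<in> prime_factors h \<and> z < p. p ^ multiplicity p h)"
proof -
  let ?S = "{p. p \<in> prime_factors h \<and> p \<le> z}" and ?R = "{p. p \<in> prime_factors h \<and> z < p}"
  define s where "s = (\<Prod>p\<in>?S. p ^ multiplicity p h)"
  have "h = (\<Prod>p\<in>prime_factors h. p ^ multiplicity p h)" using assms(1) by (intro prime_factorization_nat) simp
  also have "prime_factors h = ?S \<union> ?R" by auto
  also have "(\<Prod>p\<in>?S \<union> ?R. p ^ multiplicity p h) = s * (\<Prod>p\<in>?R. p ^ multiplicity p h)"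
    unfolding s_def by (rule prod.union_disjoint) auto
  finally have h: "h = s * (\<Prod>p\<in>?R. p ^ multiplicity p h)" .
  have s: "s > 0" unfolding s_def by (auto intro!: prod_pos simp: in_prime_factors_iff prime_gt_0_nat)
  have "ln (real s) = (\<Sum>p\<in>?S. real (multiplicity p h) * ln (real p))"
    unfolding s_def of_nat_prod
    by (subst ln_prod) (auto simp: in_prime_factors_iff prime_gt_0_nat ln_realpow)
  also have "\<dots> \<le> smooth_log z h"
    unfolding smooth_log_def by (rule sum_mono2) (auto simp: in_prime_factors_iff ln_prime_nonneg)
  finally have "ln (real s) \<le> ln (real M)" using assms(3) by linarith
  then have "s \<le> M" using s assms(2) by simp
  then show ?thesis by (subst h) simp
qed

text \<open>Turns multiplicities into divisibility by single powers, which can be counted one at a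
  time; \<open>T\<close> bounds the exponents uniformly in \<open>p\<close>.\<close>

lemma multiplicity_eq_card_powers:
  assumes "prime p" "0 < h" "h < 2 ^ T"
  shows "multiplicity p h = card {k \<in> {1..T}. p ^ k dvd (h::nat)}"
proof -
  have "p ^ multiplicity p h \<le> h" using assms(2) by (intro dvd_imp_le multiplicity_dvd) auto
  moreover have "2 ^ multiplicity p h \<le> p ^ multiplicity p h"
    using assms(1) by (intro power_mono prime_ge_2_nat) auto
  ultimately have "(2::nat) ^ multiplicity p h < 2 ^ T" using assms(3) by linarith
  then have "multiplicity p h < T" by simp
  moreover have "p ^ k dvd h \<longleftrightarrow> k \<le> multiplicity p h" for k
    by (rule power_dvd_iff_le_multiplicity) (use assms prime_gt_1_nat[of p] in simp_all)
  ultimately have "{k \<in> {1..T}. p ^ k dvd h} = {1..multiplicity p h}" by fastforce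
  then show ?thesis by simp
qed

lemma sum_inverse_powers_le:
  fixes p :: real
  assumes "2 \<le> p"
  shows "(\<Sum>k=1..T. 1 / p ^ k) \<le> 2 / p"
proof -
  \<comment> \<open>The subtracted term lets the induction run; at \<open>p = 2\<close> the bound is
    an equality.\<close>
  have "(\<Sum>k=1..T. 1 / p ^ k) \<le> 2 / p - 2 / p ^ Suc T"
  proof (induction T)
    case (Suc T)
    define u where "u = 1 / p ^ Suc T"
    have "0 \<le> u" using assms by (simp add: u_def)
    then have "2 * (u / p) \<le> u" using assms mult_right_mono[of 2 p u] by (simp add: divide_le_eq mult.commute)
    have "(\<Sum>k=1..Suc T. 1 / p ^ k) \<le> (2 / p - 2 * u) + u" using Suc by (simp add: u_def)
    also have "\<dots> \<le> 2 / p - 2 * (u / p)" using \<open>2 * (u / p) \<le> u\<close> by linarith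
    also have "2 * (u / p) = 2 / p ^ Suc (Suc T)" by (simp add: u_def)
    finally show ?case .
  qed simp
  also have "\<dots> \<le> 2 / p" using assms by simp
  finally show ?thesis .
qed

text \<open>Interchanging sums reduces the total to counts for single prime powers. Up to the factor
  \<open>c\<close>, their main terms add up over \<open>k\<close> to \<open>2 * X / p\<close> and
  then over \<open>p\<close> to \<open>4 * X * ln z\<close>; the terms \<open>+ 1\<close> occur for
  at most \<open>T\<close> exponents and \<open>z\<close> primes.\<close>

lemma sum_smooth_log_le:
  fixes h :: "'a \<Rightarrow> nat" and c X :: real
  assumes "finite J" "z > 0" "c \<ge> 0" "X \<ge> 0"
    and h: "\<And>j. j \<in> J \<Longrightarrow> 0 < h j \<and> h j < 2 ^ T"
    and count: "\<And>p k. prime p \<Longrightarrow> 0 < k \<Longrightarrow> real (card {j \<in> J. p ^ k dvd h j}) \<le> c * (X / real p ^ k + 1)"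
  shows "(\<Sum>j\<in>J. smooth_log z (h j)) \<le> c * (4 * X + real T * real z) * ln (real z)"
proof -
  let ?P = "{p. prime p \<and> p \<le> z}"
  have "(\<Sum>j\<in>J. smooth_log z (h j)) = (\<Sum>p\<in>?P. (\<Sum>j\<in>J. real (multiplicity p (h j))) * ln (real p))"
    unfolding smooth_log_def by (subst sum.swap) (simp add: sum_distrib_right)
  also have "\<dots> \<le> (\<Sum>p\<in>?P. c * (2 * X * (ln (real p) / real p) + real T * ln (real z)))"
  proof (rule sum_mono)
    fix p assume "p \<in> ?P"
    then have p: "prime p" "p \<le> z" "2 \<le> p" by (auto simp: prime_ge_2_nat)
    have "(\<Sum>j\<in>J. multiplicity p (h j)) = (\<Sum>j\<in>J. \<Sum>k | k \<in> {1..T} \<and> p ^ k dvd h j. 1)"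
      unfolding card_eq_sum[symmetric]
      by (intro sum.cong refl multiplicity_eq_card_powers[OF p(1)]) (use h in blast)+
    also have "\<dots> = (\<Sum>k\<in>{1..T}. \<Sum>j | j \<in> J \<and> p ^ k dvd h j. 1)"
      using assms(1) by (intro sum.swap_restrict) auto
    finally have "(\<Sum>j\<in>J. real (multiplicity p (h j))) = (\<Sum>k\<in>{1..T}. real (card {j \<in> J. p ^ k dvd h j}))"
      by (simp flip: of_nat_sum)
    also have "\<dots> \<le> (\<Sum>k\<in>{1..T}. c * (X / real p ^ k + 1))" using p by (intro sum_mono count) auto
    also have "\<dots> = c * (X * (\<Sum>k=1..T. 1 / real p ^ k) + real T)"
      by (simp add: sum_distrib_left sum.distrib algebra_simps)
    also have "\<dots> \<le> c * (X * (2 / real p) + real T)"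
      using assms p by (intro mult_left_mono add_right_mono sum_inverse_powers_le) auto
    finally have "(\<Sum>j\<in>J. real (multiplicity p (h j))) * ln (real p) \<le> c * (X * (2 / real p) + real T) * ln (real p)"
      using p by (intro mult_right_mono) auto
    also have "\<dots> = c * (2 * X * (ln (real p) / real p) + real T * ln (real p))" by (simp add: algebra_simps)
    also have "\<dots> \<le> c * (2 * X * (ln (real p) / real p) + real T * ln (real z))"
      using p assms by (intro mult_left_mono add_left_mono) auto
    finally show "(\<Sum>j\<in>J. real (multiplicity p (h j))) * ln (real p)
      \<le> c * (2 * X * (ln (real p) / real p) + real T * ln (real z))" .
  qed
  also have "\<dots> = c * (2 * X * (\<Sum>p\<in>?P. ln (real p) / real p) + real (card ?P) * (real T * ln (real z)))"
    by (simp add: sum_distrib_left sum.distrib distrib_left)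
  also have "\<dots> \<le> c * (2 * X * (2 * ln (real z)) + real z * (real T * ln (real z)))"
  proof (intro mult_left_mono add_mono mult_right_mono)
    have "?P \<subseteq> {1..z}" by (auto simp: Suc_le_eq prime_gt_0_nat)
    then have "card ?P \<le> card {1..z}" by (intro card_mono) auto
    then show "real (card ?P) \<le> real z" by simp
  qed (use assms sum_ln_prime_over_prime_le in auto)
  finally show ?thesis by (simp add: algebra_simps)
qed

section \<open>Lucas values attached to the pairs \<open>(a, j)\<close>\<close>

text \<open>The form \<open>1 + 2 * n * j\<close> is prime to \<open>2 * n\<close>, so only primes
  dividing \<open>a\<close> can spoil coprimality. For \<open>n > 0\<close> the Lucas value is
  nonnegative and \<open>nat\<close> is harmless.\<close>

definition pair_value :: "nat \<Rightarrow> nat \<Rightarrow> nat \<Rightarrow> nat" where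
  "pair_value n a j = nat (lucas_U (int (2 * n * a)) (- int (1 + 2 * n * j)) n)"

lemma card_roots_jacobsthal:
  assumes "prime p" "n > 0"
  shows "card {s \<in> {0..<p}. p dvd poly (jacobsthal n) s} \<le> n"
proof -
  obtain m where "n = Suc m" using assms(2) by (cases n) auto
  then have "\<not> p dvd coeff (jacobsthal n) 0"
    using jacobsthal_0[of m] assms(1) by (auto simp: poly_0_coeff_0 prime_int_iff)
  then have "card {s \<in> {0..<p}. p dvd poly (jacobsthal n) s} \<le> degree (jacobsthal n)"
    by (rule card_roots_mod_prime[OF assms(1)])
  then show ?thesis using degree_jacobsthal[of n] by linarith
qed

lemma ex_projective_root_residue:
  fixes p :: int
  assumes "prime p" "\<not> p dvd A" "p dvd lucas_U A (- b) n"
  shows "\<exists>s. s \<in> {0..<p} \<and> p dvd poly (jacobsthal n) s \<and> [s * A\<^sup>2 = b] (mod p)"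
proof -
  have cop: "coprime A p" using prime_imp_coprime[OF assms(1,2)] by (simp add: coprime_commute)
  then obtain t where t: "[t * A\<^sup>2 = b] (mod p)" using ex_projective_root by blast
  have "[t mod p * A\<^sup>2 = t * A\<^sup>2] (mod p)" by (intro cong_mult) (auto simp: cong_def)
  with t have "[t mod p * A\<^sup>2 = b] (mod p)" by (rule cong_trans[rotated])
  moreover from this have "p dvd poly (jacobsthal n) (t mod p)"
    using dvd_jacobsthal_projective_root cop assms(3) by blast
  moreover have "t mod p \<in> {0..<p}" using assms(1) by (simp add: prime_gt_0_int)
  ultimately show ?thesis by blast
qed

lemma int_pair_value:
  assumes "n > 0"
  shows "int (pair_value n a j) = lucas_U (int (2 * n * a)) (- int (1 + 2 * n * j)) n"
proof -
  \<comment> \<open>A crude size: \<open>1 \<le> y\<close> gives \<open>b \<le> y \<le> y^2\<close>,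
    and only nonnegativity is wanted here.\<close>
  define y where "y = int (2 * n * a + (1 + 2 * n * j))"
  have "int (1 + 2 * n * j) \<le> y" "1 \<le> y" by (simp_all add: y_def)
  have "y * 1 \<le> y * y" by (rule mult_left_mono) (use \<open>1 \<le> y\<close> in linarith)+
  with \<open>int (1 + 2 * n * j) \<le> y\<close> have "int (1 + 2 * n * j) \<le> y\<^sup>2"
    unfolding power2_eq_square by linarith
  then have "0 \<le> lucas_U (int (2 * n * a)) (- int (1 + 2 * n * j)) n"
    using lucas_U_neg_bounds[of "int (2 * n * a)" y "int (1 + 2 * n * j)" "n - 1"] assms by (simp add: y_def)
  then show ?thesis by (simp add: pair_value_def)
qed

lemma pair_value_le:
  assumes "n > 0" "a \<le> M" "j < 2 * M\<^sup>2"
  shows "pair_value n a j \<le> (8 * n * M) ^ (n - 1)"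
proof -
  have j: "1 + j \<le> 2 * M\<^sup>2" using assms by simp
  \<comment> \<open>The size parameter is \<open>4 * n * M\<close>: it bounds \<open>A\<close>, and
    its square bounds \<open>b\<close>.\<close>
  have "1 + 2 * n * j \<le> 2 * n * (1 + j)" using assms by simp
  also have "\<dots> \<le> 2 * n * (2 * M\<^sup>2)" using j by (rule mult_left_mono) simp
  also have "\<dots> \<le> 4 * n * M\<^sup>2 * (4 * n)" using assms by simp
  also have "\<dots> = (4 * n * M)\<^sup>2" by (simp add: power2_eq_square)
  finally have b: "int (1 + 2 * n * j) \<le> (int (4 * n * M))\<^sup>2" by (simp only: of_nat_le_iff flip: of_nat_power)
  have "2 * n * a \<le> 4 * n * M" using assms by (simp add: mult_le_mono)
  then have "lucas_U (int (2 * n * a)) (- int (1 + 2 * n * j)) (Suc (n - 1)) \<le> (2 * int (4 * n * M)) ^ (n - 1)"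
    using lucas_U_neg_bounds[OF _ _ _ b, of "int (2 * n * a)" "n - 1"] by linarith
  moreover have "Suc (n - 1) = n" "2 * int (4 * n * M) = int (8 * n * M)" using assms by simp_all
  ultimately have "int (pair_value n a j) \<le> int ((8 * n * M) ^ (n - 1))"
    unfolding int_pair_value[OF assms(1)] by (simp only: of_nat_power)
  then show ?thesis by linarith
qed

lemma pair_value_ge:
  assumes "odd n"
  shows "(1 + 2 * n * j) ^ (n div 2) \<le> pair_value n a j"
proof -
  obtain m where n: "n = 2 * m + 1" using assms by (rule oddE)
  then have m: "n div 2 = m" by simp
  have "int (1 + 2 * n * j) ^ m \<le> lucas_U (int (2 * n * a)) (- int (1 + 2 * n * j)) (2 * m + 1)"
    by (rule lucas_U_neg_odd_ge) auto
  then have "int ((1 + 2 * n * j) ^ m) \<le> int (pair_value n a j)"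
    using n by (simp add: int_pair_value)
  then show ?thesis unfolding m by linarith
qed

lemma coprime_pair_value:
  assumes "odd n" "coprime (2 * n * a) (1 + 2 * n * j)"
  shows "coprime (2 * n * a) (pair_value n a j)"
proof -
  have "coprime (int (2 * n * a)) (- int (1 + 2 * n * j))"
    using assms(2) by (simp only: coprime_minus_right_iff coprime_int_iff)
  then have "coprime (int (2 * n * a)) (int (pair_value n a j))"
    unfolding int_pair_value[OF odd_pos[OF assms(1)]] using assms(1) by (rule coprime_lucas_U_odd)
  then show ?thesis by (simp only: coprime_int_iff)
qed

lemma not_dvd_of_dvd_pair_value:
  assumes "odd n" "coprime (2 * n * a) (1 + 2 * n * j)" "prime p" "p dvd pair_value n a j"
  shows "\<not> p dvd 2 * n * a"
proof
  assume "p dvd 2 * n * a"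
  then have "is_unit p"
    by (rule coprime_common_divisor[OF coprime_pair_value[OF assms(1,2)] _ assms(4)])
  then show False using assms(3) by (simp add: not_prime_unit)
qed

text \<open>For fixed \<open>a\<close>, each counted \<open>j\<close> has its residue
  \<open>b / A^2\<close> among at most \<open>n\<close> roots modulo \<open>p\<close>. By the cross
  difference with \<open>A = A'\<close>, two \<open>j\<close> with the same root are congruent
  modulo \<open>p ^ k\<close>, so each root contributes at most one class.\<close>

lemma card_pair_value_dvd_le:
  assumes "odd n" "prime p" "k > 0"
  shows "card {j \<in> {L..<L + X}. coprime (2 * n * a) (1 + 2 * n * j) \<and> p ^ k dvd pair_value n a j}
    \<le> n * (X div p ^ k + 1)" (is "card ?J \<le> _")
proof -
  define A where "A = int (2 * n * a)"
  define b where "b j = int (1 + 2 * n * j)" for j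
  define R where "R = {s \<in> {0..<int p}. int p dvd poly (jacobsthal n) s}"
  define J where "J s = {j \<in> ?J. [s * A\<^sup>2 = b j] (mod int p)}" for s
  have n: "n > 0" using assms(1) by (rule odd_pos)
  have p: "prime (int p)" using assms(2) by simp
  have notdvd: "\<not> p dvd 2 * n * a" if "j \<in> ?J" for j
  proof (rule not_dvd_of_dvd_pair_value)
    show "p dvd pair_value n a j" using that assms(3) by (auto intro: dvd_trans[OF dvd_power])
  qed (use that assms in auto)
  have A: "\<not> int p dvd A" "\<not> int p dvd int n" "\<not> int p dvd 2 * int n" if "j \<in> ?J" for j
  proof -
    have "\<not> p dvd 2 * n" "\<not> p dvd n" using notdvd[OF that] by auto
    then have "\<not> int p dvd int (2 * n)" "\<not> int p dvd int n" by (simp_all only: int_dvd_int_iff not_False_eq_True)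
    then show "\<not> int p dvd int n" "\<not> int p dvd 2 * int n" by simp_all
    show "\<not> int p dvd A" using notdvd[OF that] by (simp only: A_def int_dvd_int_iff not_False_eq_True)
  qed
  have U: "int p ^ k dvd lucas_U A (- b j) n" if "j \<in> ?J" for j
  proof -
    have "int (p ^ k) dvd int (pair_value n a j)" using that by (simp only: int_dvd_int_iff mem_Collect_eq)
    then show ?thesis by (simp only: int_pair_value[OF n] A_def b_def of_nat_power)
  qed
  have "?J \<subseteq> (\<Union>s\<in>R. J s)"
  proof
    fix j assume j: "j \<in> ?J"
    have "int p dvd lucas_U A (- b j) n" using U[OF j] assms(3) by (meson dvd_power dvd_trans)
    then show "j \<in> (\<Union>s\<in>R. J s)"
      using ex_projective_root_residue[OF p A(1)[OF j], of "b j" n] j unfolding R_def J_def by blast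
  qed
  moreover have "finite R" unfolding R_def by (rule finite_subset[of _ "{0..<int p}"]) auto
  moreover have "finite (J s)" for s unfolding J_def by simp
  ultimately have "card ?J \<le> card (\<Union>s\<in>R. J s)" by (intro card_mono) auto
  also have "\<dots> \<le> (\<Sum>s\<in>R. card (J s))" using \<open>finite R\<close> by (rule card_UN_le)
  also have "\<dots> \<le> (\<Sum>s\<in>R. X div p ^ k + 1)"
  proof (rule sum_mono)
    fix s assume "s \<in> R"
    show "card (J s) \<le> X div p ^ k + 1"
    proof (rule card_congruent_le)
      show "J s \<subseteq> {L..<L + X}" by (auto simp: J_def)
      show "p ^ k > 0" using assms(2) by (simp add: prime_gt_0_nat)
      fix i j assume ij: "i \<in> J s" "j \<in> J s"
      then have mem: "i \<in> ?J" "j \<in> ?J" and s: "[s * A\<^sup>2 = b i] (mod int p)" "[s * A\<^sup>2 = b j] (mod int p)"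
        by (auto simp: J_def)
      have "int p ^ k dvd b i * A\<^sup>2 - b j * A\<^sup>2"
        by (rule prime_power_dvd_cross_difference[OF p A(2)[OF mem(1)] n A(1)[OF mem(1)] A(1)[OF mem(1)] s
              U[OF mem(1)] U[OF mem(2)]])
      also have "b i * A\<^sup>2 - b j * A\<^sup>2 = (2 * int n * A\<^sup>2) * (int i - int j)"
        by (simp add: b_def algebra_simps)
      finally have "int p ^ k dvd (2 * int n * A\<^sup>2) * (int i - int j)" .
      moreover have "coprime (int p ^ k) (2 * int n * A\<^sup>2)"
        using prime_imp_coprime[OF p A(1)[OF mem(1)]] prime_imp_coprime[OF p A(3)[OF mem(1)]] by simp
      ultimately have "int p ^ k dvd int i - int j" by (simp only: coprime_dvd_mult_right_iff)
      then have "[int i = int j] (mod int (p ^ k))" by (simp add: cong_iff_dvd_diff)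
      then show "[i = j] (mod p ^ k)" by (simp only: cong_int_iff)
    qed
  qed
  also have "\<dots> = card R * (X div p ^ k + 1)" by simp
  also have "\<dots> \<le> n * (X div p ^ k + 1)"
    using card_roots_jacobsthal[OF p n] unfolding R_def by (rule mult_right_mono) simp
  finally show ?thesis .
qed

section \<open>Bounded multiplicity of each value\<close>

text \<open>\<open>b / A^2\<close> and \<open>b' / A'^2\<close> are equal fractions in lowest
  terms.\<close>

lemma coprime_square_ratio_eq:
  fixes A A' b b' :: nat
  assumes "b * A'\<^sup>2 = b' * A\<^sup>2" "coprime A b" "coprime A' b'" "A > 0"
  shows "A = A' \<and> b = b'"
proof -
  have "A\<^sup>2 dvd b * A'\<^sup>2" "A'\<^sup>2 dvd b' * A\<^sup>2" using assms(1) by (metis dvd_triv_right)+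
  moreover have "coprime (A\<^sup>2) b" "coprime (A'\<^sup>2) b'" using assms by simp_all
  ultimately have "A\<^sup>2 dvd A'\<^sup>2" "A'\<^sup>2 dvd A\<^sup>2" by (simp_all only: coprime_dvd_mult_right_iff)
  then have "A\<^sup>2 = A'\<^sup>2" by (rule dvd_antisym)
  then show ?thesis using assms(1,4) by simp
qed

text \<open>A pair is encoded by the function that sends each prime factor \<open>p > z\<close> of
  \<open>h\<close> to the root \<open>b / A^2\<close> modulo \<open>p\<close>. There are at most
  \<open>E\<close> such primes, because \<open>h \<le> z ^ E\<close>, and at most \<open>n\<close>
  roots for each, so injectivity of the encoding suffices.\<close>

lemma card_pair_value_fibre_le:
  assumes n: "odd n" "n \<ge> 7" and M: "16 * n ^ 3 < M" and z: "z > 1" and h: "h \<le> z ^ E"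
    and G: "\<And>a j. (a, j) \<in> G \<Longrightarrow> a \<in> {1..M} \<and> j \<in> {M\<^sup>2..<2 * M\<^sup>2} \<and> coprime (2 * n * a) (1 + 2 * n * j)
        \<and> smooth_log z h \<le> ln (real M) \<and> pair_value n a j = h"
  shows "card G \<le> n ^ E"
proof (cases "G = {}")
  case False
  then obtain a0 j0 where g0: "(a0, j0) \<in> G" by auto
  have npos: "n > 0" and Mpos: "M > 0" using n M by simp_all
  \<comment> \<open>The hypothesis \<open>n \<ge> 7\<close> enters through
    \<open>n div 2 \<ge> 3\<close> and yields \<open>M ^ 6 \<le> h\<close>.\<close>
  have "(M\<^sup>2) ^ 3 \<le> (1 + 2 * n * j0) ^ 3"
  proof (rule power_mono)
    have "M\<^sup>2 \<le> j0" using G[OF g0] by simp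
    also have "j0 * 1 \<le> j0 * (2 * n)" using npos by (intro mult_left_mono) auto
    finally show "M\<^sup>2 \<le> 1 + 2 * n * j0" by (simp add: ac_simps)
  qed simp
  also have "\<dots> \<le> (1 + 2 * n * j0) ^ (n div 2)" using n by (intro power_increasing) auto
  also have "\<dots> \<le> h" using pair_value_ge[OF n(1)] G[OF g0] by metis
  finally have hM: "M ^ 6 \<le> h" by (simp flip: power_mult)
  then have hpos: "h > 0" using Mpos by (metis gr0I le_zero_eq power_eq_0_iff less_numeral_extra(3))

  define A where "A a = 2 * n * a" for a
  define b where "b j = 1 + 2 * n * j" for j
  define Q where "Q = {p. p \<in> prime_factors h \<and> z < p}"
  define R where "R p = {s \<in> {0..<int p}. int p dvd poly (jacobsthal n) s}" for p
  define residue where "residue x p = (SOME s. s \<in> R p \<and> [s * (int (A (fst x)))\<^sup>2 = int (b (snd x))] (mod int p))" for x p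
  have Q: "prime p" "z < p" "p dvd h" if "p \<in> Q" for p using that by (auto simp: Q_def in_prime_factors_iff)
  have finQ: "finite Q" unfolding Q_def by simp
  have finR: "finite (R p)" for p unfolding R_def by (rule finite_subset[of _ "{0..<int p}"]) auto
  have U: "lucas_U (int (A a)) (- int (b j)) n = int h" if "(a, j) \<in> G" for a j
    using G[OF that] int_pair_value[OF npos, of a j] by (simp only: A_def b_def)
  have notdvd: "\<not> int p dvd int (A a)" if "p \<in> Q" "(a, j) \<in> G" for p a j
  proof -
    have "\<not> p dvd 2 * n * a"
      by (rule not_dvd_of_dvd_pair_value[OF n(1)]) (use G[OF that(2)] Q[OF that(1)] in blast)+
    then show ?thesis by (simp only: A_def int_dvd_int_iff not_False_eq_True)
  qed
  have residue: "residue (a, j) p \<in> R p"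
    "[residue (a, j) p * (int (A a))\<^sup>2 = int (b j)] (mod int p)" if "p \<in> Q" "(a, j) \<in> G" for p a j
  proof -
    have "\<exists>s. s \<in> R p \<and> [s * (int (A a))\<^sup>2 = int (b j)] (mod int p)"
      using ex_projective_root_residue[OF _ notdvd[OF that], of "int (b j)" n] Q[OF that(1)] U[OF that(2)]
      unfolding R_def by auto
    then have "residue (a, j) p \<in> R p \<and> [residue (a, j) p * (int (A a))\<^sup>2 = int (b j)] (mod int p)"
      unfolding residue_def fst_conv snd_conv by (rule someI_ex)
    then show "residue (a, j) p \<in> R p" "[residue (a, j) p * (int (A a))\<^sup>2 = int (b j)] (mod int p)" by auto
  qed

  have "z ^ card Q = (\<Prod>p\<in>Q. z)" by simp
  also have "\<dots> \<le> (\<Prod>p\<in>Q. p)" using Q(2) by (intro prod_mono) (simp add: less_imp_le)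
  also have "\<dots> \<le> h"
  proof -
    have "[h = 0] (mod (\<Prod>p\<in>Q. p))"
      using Q by (intro coprime_cong_prod_nat) (auto simp: primes_coprime cong_0_iff)
    then show ?thesis using hpos by (auto simp: cong_0_iff dest: dvd_imp_le)
  qed
  also note h
  finally have cardQ: "card Q \<le> E" using z by simp

  define q where "q = (\<Prod>p\<in>Q. p ^ multiplicity p h)"
  have "h \<le> M * q"
    unfolding q_def Q_def using hpos Mpos G[OF g0] by (intro le_mult_rough_part) auto
  with hM have "M * M ^ 5 \<le> M * q" by (simp flip: power_Suc)
  then have q: "M ^ 5 \<le> q" using Mpos by simp
  \<comment> \<open>The two factors come from different pairs, as in a cross difference. The product
    has order \<open>M ^ 4\<close>, and \<open>16 * n ^ 3 < M\<close> absorbs the constant.\<close>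
  have small: "b j * (A a)\<^sup>2 < M ^ 5" if "(a', j) \<in> G" "(a, j') \<in> G" for a j a' j'
  proof -
    have "1 + j \<le> 2 * M\<^sup>2" using G[OF that(1)] by simp
    then have "2 * n * (1 + j) \<le> 2 * n * (2 * M\<^sup>2)" by (rule mult_left_mono) simp
    moreover have "b j \<le> 2 * n * (1 + j)" unfolding b_def using npos by simp
    ultimately have "b j \<le> 2 * n * (2 * M\<^sup>2)" by linarith
    moreover have "A a \<le> 2 * n * M" unfolding A_def using G[OF that(2)] by simp
    ultimately have "b j * (A a)\<^sup>2 \<le> 2 * n * (2 * M\<^sup>2) * (2 * n * M)\<^sup>2" by (intro mult_mono power_mono) auto
    also have "\<dots> = 16 * n ^ 3 * M ^ 4" by (simp add: power2_eq_square power3_eq_cube power4_eq_xxxx)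
    also have "\<dots> < M * M ^ 4" using M Mpos by (intro mult_strict_right_mono) auto
    also have "\<dots> = M ^ 5" by (simp flip: power_Suc)
    finally show ?thesis .
  qed

  \<comment> \<open>Restriction to \<open>Q\<close> makes the functions extensional, so they lie in
    a finite product.\<close>
  define residues where "residues x = restrict (residue x) Q" for x
  have "inj_on residues G"
  proof (rule inj_onI, clarify)
    fix a j a' j'
    assume g: "(a, j) \<in> G" "(a', j') \<in> G" and eq: "residues (a, j) = residues (a', j')"
    define D where "D = int (b j) * (int (A a'))\<^sup>2 - int (b j') * (int (A a))\<^sup>2"
    have "int p ^ multiplicity p h dvd D" if p: "p \<in> Q" for p
      unfolding D_def
    proof (rule prime_power_dvd_cross_difference[where s = "residue (a, j) p" and n = n])
      show "prime (int p)" using Q[OF p] by simp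
      show "\<not> int p dvd int n"
      proof
        assume "int p dvd int n"
        then have "int p dvd int (A a)" unfolding A_def int_dvd_int_iff by simp
        then show False using notdvd p g by blast
      qed
      show "[residue (a, j) p * (int (A a'))\<^sup>2 = int (b j')] (mod int p)"
        using residue(2)[OF p g(2)] fun_cong[OF eq, of p] p by (simp add: residues_def)
      show "int p ^ multiplicity p h dvd lucas_U (int (A a)) (- int (b j)) n"
        "int p ^ multiplicity p h dvd lucas_U (int (A a')) (- int (b j')) n"
        unfolding U[OF g(1)] U[OF g(2)] by (simp_all only: int_dvd_int_iff multiplicity_dvd flip: of_nat_power)
    qed (use npos notdvd residue p g in blast)+
    then have "[D = 0] (mod (\<Prod>p\<in>Q. int p ^ multiplicity p h))"
      using Q by (intro cong_cong_prod_coprime) (auto simp: cong_0_iff primes_coprime)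
    then have "int q dvd D" by (simp add: cong_0_iff q_def)
    \<comment> \<open>\<open>D\<close> is a difference of two nonnegative numbers below
      \<open>q\<close>, so divisibility by \<open>q\<close> leaves only
      \<open>D = 0\<close>.\<close>
    moreover have "\<bar>D\<bar> < int q"
    proof -
      have "int (b j * (A a')\<^sup>2) < int q" "int (b j' * (A a)\<^sup>2) < int q"
        using small g q by (meson le_less_trans less_le_trans of_nat_less_iff)+
      moreover have "D = int (b j * (A a')\<^sup>2) - int (b j' * (A a)\<^sup>2)" by (simp add: D_def)
      ultimately show ?thesis by linarith
    qed
    ultimately have "D = 0" using dvd_imp_le_int[of D "int q"] by auto
    then have "int (b j * (A a')\<^sup>2) = int (b j' * (A a)\<^sup>2)" by (simp add: D_def)
    then have "b j * (A a')\<^sup>2 = b j' * (A a)\<^sup>2" by linarith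
    moreover have "coprime (A a) (b j)" "coprime (A a') (b j')" using G g unfolding A_def b_def by blast+
    moreover have "A a > 0" unfolding A_def using G[OF g(1)] npos by simp
    ultimately have "A a = A a' \<and> b j = b j'" by (rule coprime_square_ratio_eq)
    then show "a = a' \<and> j = j'" unfolding A_def b_def using npos by simp
  qed
  moreover have "residues ` G \<subseteq> (\<Pi>\<^sub>E p\<in>Q. R p)"
    using residue(1) unfolding residues_def by (auto intro!: restrict_PiE_iff[THEN iffD2])
  moreover have "finite (\<Pi>\<^sub>E p\<in>Q. R p)" using finQ finR by (intro finite_PiE)
  ultimately have "card G \<le> card (\<Pi>\<^sub>E p\<in>Q. R p)" by (rule card_inj_on_le)
  also have "\<dots> = (\<Prod>p\<in>Q. card (R p))" by (rule card_PiE[OF finQ])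
  also have "\<dots> \<le> (\<Prod>p\<in>Q. n)"
    using Q(1) npos card_roots_jacobsthal unfolding R_def by (intro prod_mono) auto
  also have "\<dots> = n ^ card Q" by simp
  also have "\<dots> \<le> n ^ E" using npos cardQ by (intro power_increasing) auto
  finally show ?thesis .
qed (use n in simp)

section \<open>Density of coprime pairs\<close>

text \<open>Telescoping with \<open>1 / M - 1 / (M + 1)\<close>; at \<open>M = 2\<close> both sides
  are 0.\<close>

lemma sum_inverse_squares_le: "M \<ge> 2 \<Longrightarrow> (\<Sum>p=3..M. 1 / (real p)\<^sup>2) \<le> 1 / 2 - 1 / real M"
proof (induction M rule: dec_induct)
  case (step M)
  have "1 / (real (Suc M))\<^sup>2 \<le> 1 / (real M * real (Suc M))"
    using step by (intro divide_left_mono) (auto simp: power2_eq_square)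
  also have "\<dots> = 1 / real M - 1 / real (Suc M)" using step by (simp add: field_simps)
  finally show ?case using step by (simp add: atLeastAtMostSuc_conv)
qed simp

text \<open>A common prime cannot divide \<open>2 * n\<close>, so it divides \<open>a\<close> and
  lies between 3 and \<open>M\<close>. It spoils at most \<open>(M / p) * (X / p + 1)\<close> pairs.
  The terms with \<open>1 / p^2\<close> add up to at most half of all pairs, and the others to at
  most \<open>M\<close> for each of fewer than \<open>M\<close> primes.\<close>

lemma card_coprime_pairs_ge:
  assumes "M \<ge> 2"
  shows "real (card {x \<in> {1..M} \<times> {L..<L + X}. coprime (2 * n * fst x) (1 + 2 * n * snd x)})
    \<ge> real M * real X / 2 - (real M)\<^sup>2"
proof -
  let ?S = "{1..M} \<times> {L..<L + X}"
  let ?C = "{x \<in> ?S. coprime (2 * n * fst x) (1 + 2 * n * snd x)}"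
  define P where "P = {p. prime p \<and> 3 \<le> p \<and> p \<le> M \<and> coprime p (2 * n)}"
  define B where "B p = {a \<in> {1..M}. p dvd a} \<times> {j \<in> {L..<L + X}. p dvd 1 + 2 * n * j}" for p
  have finP: "finite P" unfolding P_def by simp
  have cardB: "real (card (B p)) \<le> real M * real X * (1 / (real p)\<^sup>2) + real M" if "p \<in> P" for p
  proof -
    have p: "p > 0" "coprime p (2 * n)" using that by (auto simp: P_def)
    have "card {j \<in> {L..<L + X}. p dvd 1 + 2 * n * j} \<le> X div p + 1"
    proof (rule card_congruent_le)
      fix i j
      assume "i \<in> {j \<in> {L..<L + X}. p dvd 1 + 2 * n * j}" "j \<in> {j \<in> {L..<L + X}. p dvd 1 + 2 * n * j}"
      then have "[1 + 2 * n * i = 0] (mod p)" "[1 + 2 * n * j = 0] (mod p)" by (auto simp: cong_0_iff)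
      then have "[1 + 2 * n * i = 1 + 2 * n * j] (mod p)" by (meson cong_sym cong_trans)
      then have "[2 * n * i = 2 * n * j] (mod p)" by (simp only: cong_add_lcancel_nat)
      then show "[i = j] (mod p)" using p(2) cong_mult_lcancel_nat coprime_commute by blast
    qed (use p in auto)
    moreover have "card {a \<in> {1..M}. p dvd a} = M div p" using p by (intro card_multiples)
    ultimately have "card (B p) \<le> (M div p) * (X div p + 1)" unfolding B_def card_cartesian_product
      by (metis mult_le_mono2)
    then have "real (card (B p)) \<le> real ((M div p) * (X div p + 1))" by (simp only: of_nat_le_iff)
    also have "\<dots> = real (M div p) * (real (X div p) + 1)" by (simp only: of_nat_mult of_nat_add of_nat_1)
    also have "\<dots> \<le> (real M / real p) * (real X / real p + 1)"
      by (intro mult_mono add_mono of_nat_div_le_of_nat) auto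
    also have "\<dots> = real M * real X * (1 / (real p)\<^sup>2) + real M / real p" by (simp add: distrib_left power2_eq_square)
    also have "real M / real p \<le> real M / 1" using p by (intro divide_left_mono) auto
    finally show ?thesis by simp
  qed
  have "?S - ?C \<subseteq> (\<Union>p\<in>P. B p)"
  proof
    fix x assume "x \<in> ?S - ?C"
    then obtain a j where x: "x = (a, j)" and aj: "a \<in> {1..M}" "j \<in> {L..<L + X}" "(a, j) \<notin> ?C" by auto
    then have "\<not> coprime (2 * n * a) (1 + 2 * n * j)" by simp
    then have "gcd (2 * n * a) (1 + 2 * n * j) \<noteq> 1" by (simp only: coprime_iff_gcd_eq_1 not_False_eq_True)
    then obtain p where p: "prime p" "p dvd 2 * n * a" "p dvd 1 + 2 * n * j"
      using prime_factor_nat dvd_gcdD1 dvd_gcdD2 by blast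
    have notdvd: "\<not> p dvd 2 * n"
    proof
      assume "p dvd 2 * n"
      then have "p dvd 2 * n * j" by (rule dvd_mult2)
      then have "p dvd 1" using p(3) by (simp only: dvd_add_left_iff)
      then show False using p(1) by (simp add: not_prime_unit)
    qed
    then have "p dvd a" using p by (simp only: prime_dvd_mult_iff simp_thms)
    moreover have "p \<noteq> 2" using notdvd by auto
    then have "3 \<le> p" using prime_ge_2_nat[OF p(1)] by simp
    moreover have "p \<le> M" using \<open>p dvd a\<close> aj(1) by (auto dest: dvd_imp_le)
    ultimately show "x \<in> (\<Union>p\<in>P. B p)"
      using p aj prime_imp_coprime[OF p(1) notdvd] unfolding x P_def B_def by blast
  qed
  moreover have "finite (\<Union>p\<in>P. B p)" using finP by (auto simp: B_def)
  ultimately have "card (?S - ?C) \<le> card (\<Union>p\<in>P. B p)" by (intro card_mono)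
  also have "\<dots> \<le> (\<Sum>p\<in>P. card (B p))" by (rule card_UN_le[OF finP])
  finally have "real (card (?S - ?C)) \<le> (\<Sum>p\<in>P. real (card (B p)))" by (simp flip: of_nat_sum)
  also have "\<dots> \<le> (\<Sum>p\<in>P. real M * real X * (1 / (real p)\<^sup>2) + real M)" by (rule sum_mono[OF cardB])
  also have "\<dots> \<le> (\<Sum>p=3..M. real M * real X * (1 / (real p)\<^sup>2) + real M)"
    by (rule sum_mono2) (auto simp: P_def)
  also have "\<dots> = real M * real X * (\<Sum>p=3..M. 1 / (real p)\<^sup>2) + real (M - 2) * real M"
    using assms by (simp add: sum.distrib sum_distrib_left)
  also have "\<dots> \<le> real M * real X * (1 / 2) + real M * real M"
  proof (intro add_mono mult_left_mono mult_right_mono)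
    have "0 \<le> 1 / real M" by simp
    then show "(\<Sum>p=3..M. 1 / (real p)\<^sup>2) \<le> 1 / 2" using sum_inverse_squares_le[OF assms] by linarith
  qed auto
  finally have bad: "real (card (?S - ?C)) \<le> real M * real X / 2 + (real M)\<^sup>2" by (simp add: power2_eq_square)
  have fin: "finite ?S" and sub: "?C \<subseteq> ?S" by auto
  have "card ?S = card ?C + card (?S - ?C)"
    using card_Diff_subset[OF finite_subset[OF sub fin] sub] card_mono[OF fin sub] by linarith
  moreover have "card ?S = M * X" by (simp add: card_cartesian_product)
  ultimately have "card ?C + card (?S - ?C) = M * X" by (simp only:)
  then have "real (card ?C) + real (card (?S - ?C)) = real M * real X"
    by (simp only: flip: of_nat_add of_nat_mult)
  with bad show ?thesis by linarith
qed

section \<open>Counting distinct values for special bounds\<close>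

lemma pair_value_in_lucas_values:
  assumes "n > 0" "a > 0" "pair_value n a j \<le> N"
  shows "int (pair_value n a j) \<in> lucas_values n N"
proof -
  have "nondegenerate (int (2 * n * a)) (- int (1 + 2 * n * j))"
  proof (rule nondegenerate_neg)
    have "0 < int (1 + 2 * n * j)" unfolding of_nat_0_less_iff by simp
    then show "- int (1 + 2 * n * j) < 0" by linarith
  qed (use assms in simp)
  moreover have "int (pair_value n a j) = \<bar>lucas_U (int (2 * n * a)) (- int (1 + 2 * n * j)) n\<bar>"
    unfolding int_pair_value[OF assms(1), symmetric] by simp
  ultimately show ?thesis using assms(3) unfolding lucas_values_def by auto
qed

text \<open>\<open>K = 20 * n\<close> is fitted to the first moment: the total of
  \<open>smooth_log\<close> is at most \<open>5 * n * M^3 * ln z\<close>, a quarter of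
  \<open>M^3 * ln M\<close>. \<open>E\<close> is chosen so that
  \<open>(8 * n * M) ^ (n - 1) \<le> z ^ E\<close> once \<open>8 * n \<le> z\<close>.\<close>

lemma card_lucas_values_ge_cube:
  fixes n z :: nat
  defines "K \<equiv> 20 * n"
  defines "E \<equiv> (K + 1) * (n - 1)"
  defines "M \<equiv> z ^ K"
  assumes n: "odd n" "n \<ge> 7" and z: "z \<ge> 8 * n + E"
  shows "real M ^ 3 \<le> 8 * real n ^ E * real (card (lucas_values n ((8 * n * M) ^ (n - 1))))"
proof -
  define S where "S = {1..M} \<times> {M\<^sup>2..<M\<^sup>2 + M\<^sup>2}"
  define C where "C = {x \<in> S. coprime (2 * n * fst x) (1 + 2 * n * snd x)}"
  define v where "v x = pair_value n (fst x) (snd x)" for x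
  define Good where "Good = {x \<in> C. smooth_log z (v x) \<le> ln (real M)}"
  define Bad where "Bad = {x \<in> C. \<not> smooth_log z (v x) \<le> ln (real M)}"
  have npos: "n > 0" using n by simp
  have z8: "8 * n \<le> z" "E \<le> z" using z by simp_all
  then have z1: "z > 1" using n by simp
  have E: "E > 0" using n by (simp add: E_def)
  have "z ^ 4 \<le> M" unfolding M_def K_def using z1 n by (intro power_increasing) auto
  moreover have "(8 * n) ^ 4 \<le> z ^ 4" using z8(1) by (rule power_mono) simp
  ultimately have M8: "(8 * n) ^ 4 \<le> M" by linarith
  have "16 * n ^ 3 * 1 < 16 * n ^ 3 * (256 * n)" using npos by (intro mult_strict_left_mono) auto
  also have "\<dots> = (8 * n) ^ 4" by (simp add: power3_eq_cube power4_eq_xxxx)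
  finally have M16: "16 * n ^ 3 < M" using M8 by linarith
  have "(8 * n) ^ 1 \<le> (8 * n) ^ 4" using npos by (intro power_increasing) auto
  with M8 n have Mge: "M \<ge> 8" by simp
  have fin: "finite S" "finite C" "finite Good" "finite Bad" by (simp_all add: S_def C_def Good_def Bad_def)

  have v: "v x \<le> (8 * n * M) ^ (n - 1)" "0 < v x" if "x \<in> S" for x
  proof -
    show "v x \<le> (8 * n * M) ^ (n - 1)"
      using that unfolding v_def S_def by (intro pair_value_le npos) auto
    have "1 \<le> (1 + 2 * n * snd x) ^ (n div 2)" by simp
    also have "\<dots> \<le> v x" unfolding v_def by (rule pair_value_ge[OF n(1)])
    finally show "0 < v x" by simp
  qed
  have "(8 * n * M) ^ (n - 1) \<le> (z * M) ^ (n - 1)" using z8 by (intro power_mono mult_right_mono) auto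
  also have "\<dots> = z ^ E" by (simp add: M_def E_def mult.commute flip: power_Suc power_mult)
  finally have vz: "v x \<le> z ^ E" if "x \<in> S" for x using v(1)[OF that] by linarith
  \<comment> \<open>From \<open>z < 2 ^ z\<close>; this supplies \<open>T = z * E\<close> for the
    first moment bound.\<close>
  have "z ^ E < (2 ^ z) ^ E" using E by (intro power_strict_mono) auto
  then have v2: "v x < 2 ^ (z * E)" if "x \<in> S" for x using vz[OF that] by (simp add: power_mult)

  define X where "X = real (M\<^sup>2)"
  have lnz: "0 < ln (real z)" using z1 by simp
  \<comment> \<open>The error term \<open>T * z\<close> is at most \<open>X\<close>, so
    \<open>4 * X\<close> becomes \<open>5 * X\<close> in each row.\<close>
  have Ez: "real (z * E) * real z \<le> X"
  proof -
    have "z * E * z \<le> z * z * z" using z8 by simp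
    also have "\<dots> = z ^ 3" by (simp add: power3_eq_cube)
    also have "\<dots> \<le> z ^ (K * 2)" using z1 n by (intro power_increasing) (auto simp: K_def)
    also have "\<dots> = M\<^sup>2" by (simp add: M_def power_mult)
    finally show ?thesis unfolding X_def by (simp only: of_nat_le_iff flip: of_nat_mult)
  qed
  have row: "(\<Sum>j | j \<in> {M\<^sup>2..<M\<^sup>2 + M\<^sup>2} \<and> (a, j) \<in> C. smooth_log z (v (a, j))) \<le> real n * (5 * X) * ln (real z)"
    if a: "a \<in> {1..M}" for a
  proof -
    let ?J = "{j. j \<in> {M\<^sup>2..<M\<^sup>2 + M\<^sup>2} \<and> (a, j) \<in> C}"
    have "(\<Sum>j\<in>?J. smooth_log z (v (a, j))) \<le> real n * (4 * X + real (z * E) * real z) * ln (real z)"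
    proof (rule sum_smooth_log_le)
      show "0 < v (a, j) \<and> v (a, j) < 2 ^ (z * E)" if "j \<in> ?J" for j
        using that v v2 by (simp add: C_def)
      fix p k :: nat
      assume pk: "prime p" "0 < k"
      have "card {j \<in> ?J. p ^ k dvd v (a, j)}
          \<le> card {j \<in> {M\<^sup>2..<M\<^sup>2 + M\<^sup>2}. coprime (2 * n * a) (1 + 2 * n * j) \<and> p ^ k dvd pair_value n a j}"
        by (intro card_mono) (auto simp: C_def v_def)
      also have "\<dots> \<le> n * (M\<^sup>2 div p ^ k + 1)" by (rule card_pair_value_dvd_le[OF n(1) pk])
      finally have "real (card {j \<in> ?J. p ^ k dvd v (a, j)}) \<le> real (n * (M\<^sup>2 div p ^ k + 1))"
        by (simp only: of_nat_le_iff)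
      also have "\<dots> = real n * (real (M\<^sup>2 div p ^ k) + 1)" by (simp only: of_nat_mult of_nat_add of_nat_1)
      also have "\<dots> \<le> real n * (X / real p ^ k + 1)"
        unfolding X_def of_nat_power[of p k, symmetric]
        by (intro mult_left_mono add_right_mono of_nat_div_le_of_nat of_nat_0_le_iff)
      finally show "real (card {j \<in> ?J. p ^ k dvd v (a, j)}) \<le> real n * (X / real p ^ k + 1)" .
    qed (use z1 in \<open>simp_all add: X_def\<close>)
    also have "\<dots> \<le> real n * (5 * X) * ln (real z)"
      using Ez lnz by (intro mult_right_mono mult_left_mono) auto
    finally show ?thesis .
  qed
  \<comment> \<open>Markov's inequality: each bad pair contributes more than
    \<open>ln M\<close>.\<close>
  have "real (card Bad) * ln (real M) = (\<Sum>x\<in>Bad. ln (real M))" by simp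
  also have "\<dots> \<le> (\<Sum>x\<in>Bad. smooth_log z (v x))" by (intro sum_mono) (auto simp: Bad_def)
  also have "\<dots> \<le> (\<Sum>x\<in>C. smooth_log z (v x))"
    using fin by (intro sum_mono2) (auto simp: Bad_def smooth_log_nonneg)
  also have "C = Sigma {1..M} (\<lambda>a. {j. j \<in> {M\<^sup>2..<M\<^sup>2 + M\<^sup>2} \<and> (a, j) \<in> C})"
    by (auto simp: C_def S_def)
  also have "(\<Sum>x\<in>\<dots>. smooth_log z (v x))
      = (\<Sum>a\<in>{1..M}. \<Sum>j | j \<in> {M\<^sup>2..<M\<^sup>2 + M\<^sup>2} \<and> (a, j) \<in> C. smooth_log z (v (a, j)))"
    by (subst sum.Sigma) auto
  also have "\<dots> \<le> (\<Sum>a\<in>{1..M}. real n * (5 * X) * ln (real z))" by (rule sum_mono[OF row])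
  also have "\<dots> = real M ^ 3 / 4 * (real K * ln (real z))"
    by (simp add: X_def K_def power2_eq_square power3_eq_cube)
  also have "real K * ln (real z) = ln (real M)" using z1 by (simp add: M_def ln_realpow)
  finally have "real (card Bad) * ln (real M) \<le> real M ^ 3 / 4 * ln (real M)" .
  moreover have "0 < ln (real M)" using Mge by simp
  ultimately have bad: "real (card Bad) \<le> real M ^ 3 / 4" by simp
  have "real (card C) \<ge> real M * real (M\<^sup>2) / 2 - (real M)\<^sup>2"
    unfolding C_def S_def using Mge by (intro card_coprime_pairs_ge) simp
  then have C: "real (card C) \<ge> real M ^ 3 / 2 - (real M)\<^sup>2" by (simp add: power2_eq_square power3_eq_cube)
  have "8 * (real M)\<^sup>2 \<le> real M * (real M)\<^sup>2" using Mge by (intro mult_right_mono) auto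
  then have M2: "(real M)\<^sup>2 \<le> real M ^ 3 / 8" by (simp add: power2_eq_square power3_eq_cube)
  have "C = Good \<union> Bad" "Good \<inter> Bad = {}" by (auto simp: Good_def Bad_def)
  then have "card C = card Good + card Bad" using fin by (simp add: card_Un_disjoint)
  \<comment> \<open>One half for the coprime pairs, minus an eighth for the error \<open>M^2\<close>
    and a quarter for the bad pairs, leaves an eighth of \<open>M^3\<close>.\<close>
  then have good: "real M ^ 3 / 8 \<le> real (card Good)" using bad C M2 by simp

  have "card Good = (\<Sum>h\<in>v ` Good. card {x \<in> Good. v x = h})"
    unfolding card_eq_sum by (rule sum.image_gen[OF fin(3)])
  also have "\<dots> \<le> (\<Sum>h\<in>v ` Good. n ^ E)"
  proof (rule sum_mono)
    fix h assume "h \<in> v ` Good"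
    then obtain x where x: "x \<in> Good" "h = v x" by auto
    show "card {x \<in> Good. v x = h} \<le> n ^ E"
    proof (rule card_pair_value_fibre_le[OF n M16 z1])
      show "h \<le> z ^ E" using x vz by (simp add: Good_def C_def)
    next
      fix a j assume "(a, j) \<in> {x \<in> Good. v x = h}"
      then show "a \<in> {1..M} \<and> j \<in> {M\<^sup>2..<2 * M\<^sup>2} \<and> coprime (2 * n * a) (1 + 2 * n * j)
          \<and> smooth_log z h \<le> ln (real M) \<and> pair_value n a j = h"
        by (auto simp: Good_def C_def S_def v_def)
    qed
  qed
  also have "\<dots> = card (int ` v ` Good) * n ^ E" by (simp add: card_image)
  also have "\<dots> \<le> card (lucas_values n ((8 * n * M) ^ (n - 1))) * n ^ E"
  proof (intro mult_right_mono card_mono finite_lucas_values)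
    show "int ` v ` Good \<subseteq> lucas_values n ((8 * n * M) ^ (n - 1))"
    proof clarify
      fix a j assume "(a, j) \<in> Good"
      then have S: "(a, j) \<in> S" by (simp add: Good_def C_def)
      then have "a > 0" by (simp add: S_def)
      then show "int (v (a, j)) \<in> lucas_values n ((8 * n * M) ^ (n - 1))"
        using v(1)[OF S] npos unfolding v_def fst_conv snd_conv by (intro pair_value_in_lucas_values)
    qed
  qed simp
  finally have "real (card Good) \<le> real (card (lucas_values n ((8 * n * M) ^ (n - 1)))) * real n ^ E"
    by (simp only: of_nat_le_iff flip: of_nat_mult of_nat_power)
  with good show ?thesis by (simp add: mult.commute)
qed

section \<open>Passage to arbitrary \<open>N\<close>\<close>

lemma lucas_values_mono: "N \<le> N' \<Longrightarrow> lucas_values n N \<subseteq> lucas_values n N'"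
  by (auto simp: lucas_values_def)

text \<open>The preceding count covers only bounds of the form \<open>C * z ^ w\<close>. For general
  \<open>N\<close>, the largest \<open>z\<close> with \<open>C * z ^ w \<le> N\<close> also
  satisfies \<open>N < C * 2 ^ w * z ^ w\<close>, so only a constant is lost.\<close>

lemma card_lucas_values_ge_powr:
  assumes n: "odd n" "n \<ge> 7"
  shows "\<exists>c>0. \<exists>N\<^sub>0. \<forall>N\<ge>N\<^sub>0. c * real N powr (3 / (real n - 1)) \<le> real (card (lucas_values n N))"
proof -
  define K where "K = 20 * n"
  define E where "E = (K + 1) * (n - 1)"
  define w where "w = K * (n - 1)"
  define e where "e = 3 / (real n - 1)"
  define C where "C = (8 * n) ^ (n - 1)"
  define z0 where "z0 = 8 * n + E"
  \<comment> \<open>The inverse of the losses: \<open>8 * n ^ E\<close> from the count and the power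
    of \<open>C * 2 ^ w\<close> from rounding \<open>N\<close>.\<close>
  define c where "c = 1 / (8 * real n ^ E * real (C * 2 ^ w) powr e)"
  have Cpos: "C > 0" and wpos: "w > 0" and e: "e > 0" using n by (simp_all add: C_def w_def K_def e_def)
  have "c > 0" using n Cpos by (simp add: c_def)
  moreover have "c * real N powr e \<le> real (card (lucas_values n N))" if N: "C * z0 ^ w \<le> N" for N
  proof -
    define Z where "Z = {z. C * z ^ w \<le> N}"
    have "Z \<subseteq> {..N}"
    proof
      fix z assume "z \<in> Z"
      then have "C * z ^ w \<le> N" by (simp add: Z_def)
      moreover have "z ^ w \<le> C * z ^ w" using Cpos by simp
      moreover have "z \<le> z ^ w" using wpos by (cases "z = 0") (auto intro: self_le_power)
      ultimately show "z \<in> {..N}" unfolding atMost_iff by linarith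
    qed
    then have finZ: "finite Z" using finite_subset by blast
    have z0Z: "z0 \<in> Z" using N by (simp add: Z_def)
    define z where "z = Max Z"
    have zZ: "z \<in> Z" unfolding z_def using finZ z0Z by (intro Max_in) auto
    have zz0: "z0 \<le> z" unfolding z_def using finZ z0Z by (intro Max_ge)
    have zpos: "1 \<le> z" using zz0 n by (simp add: z0_def)
    have "Suc z \<notin> Z" using Max_ge[OF finZ, of "Suc z"] unfolding z_def[symmetric] by auto
    then have "N < C * Suc z ^ w" by (simp add: Z_def)
    also have "\<dots> \<le> C * (2 * z) ^ w" using zpos by (intro mult_left_mono power_mono) auto
    also have "\<dots> = C * 2 ^ w * z ^ w" by (simp add: power_mult_distrib)
    finally have "real N \<le> real (C * 2 ^ w * z ^ w)" by linarith
    then have "real N powr e \<le> real (C * 2 ^ w * z ^ w) powr e" using e by (intro powr_mono2) auto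
    also have "\<dots> = real (C * 2 ^ w) powr e * real (z ^ w) powr e" by (simp add: powr_mult)
    also have "real (z ^ w) powr e = real z powr (real w * e)"
      using zpos by (simp add: powr_powr flip: powr_realpow)
    \<comment> \<open>The exponents match: \<open>z\<close> to the power \<open>3 * K\<close> is the
      cube of \<open>M = z ^ K\<close>.\<close>
    also have "real w * e = real (K * 3)" using n by (simp add: w_def e_def of_nat_diff)
    also have "real z powr real (K * 3) = real (z ^ K) ^ 3"
      using zpos by (subst powr_realpow) (auto simp: power_mult)
    finally have "real N powr e \<le> real (C * 2 ^ w) powr e * real (z ^ K) ^ 3" .
    also have "\<dots> \<le> real (C * 2 ^ w) powr e
        * (8 * real n ^ E * real (card (lucas_values n ((8 * n * z ^ K) ^ (n - 1)))))"
      using card_lucas_values_ge_cube[OF n, of z] zz0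
      by (intro mult_left_mono) (simp_all only: z0_def E_def K_def powr_ge_zero)
    also have "(8 * n * z ^ K) ^ (n - 1) = C * z ^ w"
      by (simp only: C_def w_def power_mult_distrib power_mult)
    finally have "real N powr e \<le> real (C * 2 ^ w) powr e
        * (8 * real n ^ E * real (card (lucas_values n (C * z ^ w))))" .
    then have "c * real N powr e \<le> real (card (lucas_values n (C * z ^ w)))"
      using n Cpos by (simp add: c_def field_simps)
    also have "card (lucas_values n (C * z ^ w)) \<le> card (lucas_values n N)"
      using zZ by (intro card_mono finite_lucas_values lucas_values_mono) (simp add: Z_def)
    finally show ?thesis by simp
  qed
  ultimately show ?thesis unfolding e_def by blast
qed

theorem theorem2p5:
  fixes n :: nat
  assumes "n \<ge> 7" and "odd n"
  shows "\<exists>c\<^sub>1::real. c\<^sub>1 > 0 \<and>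
    (\<forall>N::nat. N > 0 \<longrightarrow> card (lucas_values n N) > 0 \<longrightarrow>
       real (card (lucas_values n N)) \<ge> c\<^sub>1 * real N powr (3 / (real n - 1))) \<and>
    (\<forall>N::nat. N > 0 \<longrightarrow> card (lucas_values_ge n N) > 0 \<longrightarrow>
       real (card (lucas_values_ge n N)) \<ge> c\<^sub>1 * real N powr (3 / (real n - 1)))"
proof -
  define e where "e = 3 / (real n - 1)"
  have e: "e > 0" using assms by (simp add: e_def)
  obtain c N0 where c: "c > 0"
    and large: "\<And>N. N0 \<le> N \<Longrightarrow> c * real N powr e \<le> real (card (lucas_values n N))"
    using card_lucas_values_ge_powr[OF assms(2,1)] unfolding e_def by blast
  \<comment> \<open>Below \<open>N0\<close> the bound is made at most 1, so a positive cardinality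
    suffices; \<open>Suc\<close> keeps the base positive when \<open>N0 = 0\<close>.\<close>
  define d where "d = 1 / real (Suc N0) powr e"
  have d: "d > 0" by (simp add: d_def)
  have small: "d * real N powr e \<le> 1" if "N < N0" for N
  proof -
    have "real N powr e \<le> real (Suc N0) powr e" using that e by (intro powr_mono2) auto
    then show ?thesis by (simp add: d_def divide_le_eq)
  qed
  \<comment> \<open>\<open>k\<close> stands for either cardinality; that of the union dominates
    because the union contains the index \<open>m = n\<close>.\<close>
  have bound: "min c d * real N powr e \<le> real k" if "k > 0" "card (lucas_values n N) \<le> k" for N k
  proof (cases "N0 \<le> N")
    case True
    have "min c d * real N powr e \<le> c * real N powr e" by (intro mult_right_mono) auto
    then show ?thesis using large[OF True] that(2) by linarith
  next
    case False
    have "min c d * real N powr e \<le> d * real N powr e" by (intro mult_right_mono) auto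
    then show ?thesis using small[of N] False that(1) by linarith
  qed
  have "card (lucas_values n N) \<le> card (lucas_values_ge n N)" for N
    by (intro card_mono finite_lucas_values_ge) (auto simp: lucas_values_ge_def)
  then show ?thesis
    using c d bound unfolding e_def by (intro exI[of _ "min c d"]) auto
qed

end
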